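(* Let $k$ be a commutative field and let $\Lambda$ be the $k[\frac{d}{dt}]$-module defined by generators $w_1,\dots,w_\mu$ and relations $P\,(w_1,\dots,w_\mu)^{\mathsf T}=0$, where $P\in k[\frac{d}{dt}]^{\nu\times\mu}$ is a presentation matrix. Then ${\rm rk}(\Lambda)=\mu-{\rm rk}(P)$.
   Context: $k[\frac{d}{dt}]$ is the ring of linear differential operators $\sum_{\rm finite}a_\alpha\frac{d^\alpha}{dt^\alpha}$, $a_\alpha\in k$, i.e. a polynomial ring in one indeterminate, also written $k[s]$ with $s=\frac{d}{dt}$; $k(s)$ is its quotient field. Explicitly $\Lambda=\mathfrak{F}/\mathfrak{E}$, where $\mathfrak{F}$ is the free module with basis $W_1,\dots,W_\mu$ and $\mathfrak{E}$ is the submodule spanned by $\sum_{\kappa=1}^{\mu}a_{\iota\kappa}W_\kappa$, $\iota=1,\dots,\nu$, with $P=(a_{\iota\kappa})$. The rank ${\rm rk}(\Lambda)$ is the rank of the free module $\Lambda/\Lambda_{\rm tor}$, where $\Lambda_{\rm tor}$ is the torsion submodule. ${\rm rk}(P)$ is the rank of $P$ as a matrix over $k(s)$. *)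

theory Defs
  imports "HOL-Algebra.QuotRing" "Jordan_Normal_Form.DL_Rank"
begin

section \<open>Quotient modules\<close>

text \<open>As in \<^const>\<open>FactRing\<close>, the elements of the quotient are the cosets of \<open>N\<close>. The fields
  \<open>mult\<close> and \<open>one\<close> of the underlying ring record play no role in a module.\<close>

definition quotient_module :: "('a, 'b, 'm) module_scheme \<Rightarrow> 'b set \<Rightarrow> ('a, 'b set) module" where
  "quotient_module M N =
    \<lparr>carrier = a_rcosets\<^bsub>M\<^esub> N, mult = undefined, one = undefined, zero = N, add = set_add M,
     smult = (\<lambda>a X. \<Union>x\<in>X. N +>\<^bsub>M\<^esub> (a \<odot>\<^bsub>M\<^esub> x))\<rparr>"

lemma submodule_abelian_subgroup:
  assumes "submodule R N M"
  shows "abelian_subgroup N M"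
proof -
  interpret submodule R N M by fact
  interpret Module.module R M by (rule module)
  have inv: "\<ominus>\<^bsub>M\<^esub> x \<in> N" if "x \<in> N" for x
  proof -
    have x: "x \<in> carrier M"
      using that subset by blast
    have "(\<ominus>\<^bsub>R\<^esub> \<one>\<^bsub>R\<^esub>) \<odot>\<^bsub>M\<^esub> x = \<ominus>\<^bsub>M\<^esub> x"
      using smult_l_minus[of "\<one>\<^bsub>R\<^esub>" x] x by simp
    moreover have "(\<ominus>\<^bsub>R\<^esub> \<one>\<^bsub>R\<^esub>) \<odot>\<^bsub>M\<^esub> x \<in> N"
      using that submodule.smult_closed[OF assms] by auto
    ultimately show ?thesis
      by simp
  qed
  have "subgroup N (add_monoid M)"
    using subset inv by unfold_locales (auto simp: a_inv_def)
  then show ?thesis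
    by (intro abelian_subgroupI3 additive_subgroupI) (simp_all add: M.abelian_group_axioms)
qed

lemma quotient_module_smult:
  assumes "submodule R N M" "a \<in> carrier R" "x \<in> carrier M"
  shows "a \<odot>\<^bsub>quotient_module M N\<^esub> (N +>\<^bsub>M\<^esub> x) = N +>\<^bsub>M\<^esub> (a \<odot>\<^bsub>M\<^esub> x)"
proof -
  interpret submodule R N M by fact
  interpret Module.module R M by (rule module)
  interpret abelian_subgroup N M
    by (rule submodule_abelian_subgroup) fact
  have "N +>\<^bsub>M\<^esub> (a \<odot>\<^bsub>M\<^esub> y) = N +>\<^bsub>M\<^esub> (a \<odot>\<^bsub>M\<^esub> x)" if "y \<in> N +>\<^bsub>M\<^esub> x" for y
  proof -
    from that obtain n where n: "n \<in> N" "y = n \<oplus>\<^bsub>M\<^esub> x"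
      by (auto simp: a_r_coset_def')
    then have "a \<odot>\<^bsub>M\<^esub> y = (a \<odot>\<^bsub>M\<^esub> n) \<oplus>\<^bsub>M\<^esub> (a \<odot>\<^bsub>M\<^esub> x)"
      using assms subset by (auto simp: smult_r_distr)
    moreover have "a \<odot>\<^bsub>M\<^esub> n \<in> N"
      using n assms by auto
    ultimately have "a \<odot>\<^bsub>M\<^esub> y \<in> N +>\<^bsub>M\<^esub> (a \<odot>\<^bsub>M\<^esub> x)"
      by (auto simp: a_r_coset_def')
    then show ?thesis
      using a_repr_independence' assms by auto
  qed
  moreover have "x \<in> N +>\<^bsub>M\<^esub> x"
    using a_rcos_self assms by auto
  ultimately have "(\<Union>y\<in>N +>\<^bsub>M\<^esub> x. N +>\<^bsub>M\<^esub> (a \<odot>\<^bsub>M\<^esub> y)) = N +>\<^bsub>M\<^esub> (a \<odot>\<^bsub>M\<^esub> x)"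
    by blast
  then show ?thesis
    by (simp add: quotient_module_def)
qed

lemma quotient_module_is_module:
  assumes "submodule R N M"
  shows "Module.module R (quotient_module M N)"
proof -
  interpret submodule R N M by fact
  interpret Module.module R M by (rule module)
  interpret abelian_subgroup N M
    by (rule submodule_abelian_subgroup) fact
  let ?Q = "quotient_module M N"
  have rep: "\<exists>x\<in>carrier M. X = N +>\<^bsub>M\<^esub> x" if "X \<in> carrier ?Q" for X
    using that by (auto simp: quotient_module_def A_RCOSETS_def')
  have cl: "N +>\<^bsub>M\<^esub> x \<in> carrier ?Q" if "x \<in> carrier M" for x
    using that a_rcosetsI[OF a_subset] by (auto simp: quotient_module_def)
  have ad: "(N +>\<^bsub>M\<^esub> x) \<oplus>\<^bsub>?Q\<^esub> (N +>\<^bsub>M\<^esub> y) = N +>\<^bsub>M\<^esub> (x \<oplus>\<^bsub>M\<^esub> y)"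
    if "x \<in> carrier M" "y \<in> carrier M" for x y
    using that a_rcos_sum by (simp add: quotient_module_def)
  have ze: "\<zero>\<^bsub>?Q\<^esub> = N +>\<^bsub>M\<^esub> \<zero>\<^bsub>M\<^esub>"
    using a_coset_add_zero[OF a_subset] by (simp add: quotient_module_def)
  note sm = quotient_module_smult[OF assms]
  show ?thesis
  proof (rule moduleI)
    show "cring R"
      by (rule R.is_cring)
    show "abelian_group ?Q"
    proof (rule abelian_groupI)
      show "X \<oplus>\<^bsub>?Q\<^esub> Y \<in> carrier ?Q" if "X \<in> carrier ?Q" "Y \<in> carrier ?Q" for X Y
        using rep[OF that(1)] rep[OF that(2)] by (auto simp: ad cl)
      show "\<zero>\<^bsub>?Q\<^esub> \<in> carrier ?Q"
        unfolding ze by (rule cl) simp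
      show "X \<oplus>\<^bsub>?Q\<^esub> Y \<oplus>\<^bsub>?Q\<^esub> Z = X \<oplus>\<^bsub>?Q\<^esub> (Y \<oplus>\<^bsub>?Q\<^esub> Z)"
        if "X \<in> carrier ?Q" "Y \<in> carrier ?Q" "Z \<in> carrier ?Q" for X Y Z
        using rep[OF that(1)] rep[OF that(2)] rep[OF that(3)] by (auto simp: ad M.a_assoc)
      show "X \<oplus>\<^bsub>?Q\<^esub> Y = Y \<oplus>\<^bsub>?Q\<^esub> X" if "X \<in> carrier ?Q" "Y \<in> carrier ?Q" for X Y
        using rep[OF that(1)] rep[OF that(2)] by (auto simp: ad M.a_comm)
      show "\<zero>\<^bsub>?Q\<^esub> \<oplus>\<^bsub>?Q\<^esub> X = X" if "X \<in> carrier ?Q" for X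
        using rep[OF that] unfolding ze by (auto simp: ad)
      show "\<exists>Y\<in>carrier ?Q. Y \<oplus>\<^bsub>?Q\<^esub> X = \<zero>\<^bsub>?Q\<^esub>" if X: "X \<in> carrier ?Q" for X
      proof -
        from rep[OF X] obtain x where "x \<in> carrier M" "X = N +>\<^bsub>M\<^esub> x"
          by blast
        then show ?thesis
          unfolding ze by (intro bexI[of _ "N +>\<^bsub>M\<^esub> (\<ominus>\<^bsub>M\<^esub> x)"]) (simp_all add: ad cl M.l_neg)
      qed
    qed
    show "a \<odot>\<^bsub>?Q\<^esub> X \<in> carrier ?Q" if "a \<in> carrier R" "X \<in> carrier ?Q" for a X
      using that rep[of X] by (auto simp: sm cl)
    show "(a \<oplus>\<^bsub>R\<^esub> b) \<odot>\<^bsub>?Q\<^esub> X = a \<odot>\<^bsub>?Q\<^esub> X \<oplus>\<^bsub>?Q\<^esub> b \<odot>\<^bsub>?Q\<^esub> X"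
      if "a \<in> carrier R" "b \<in> carrier R" "X \<in> carrier ?Q" for a b X
      using that rep[of X] by (auto simp: sm ad smult_l_distr)
    show "a \<odot>\<^bsub>?Q\<^esub> (X \<oplus>\<^bsub>?Q\<^esub> Y) = a \<odot>\<^bsub>?Q\<^esub> X \<oplus>\<^bsub>?Q\<^esub> a \<odot>\<^bsub>?Q\<^esub> Y"
      if "a \<in> carrier R" "X \<in> carrier ?Q" "Y \<in> carrier ?Q" for a X Y
      using that rep[of X] rep[of Y] by (auto simp: sm ad smult_r_distr)
    show "(a \<otimes>\<^bsub>R\<^esub> b) \<odot>\<^bsub>?Q\<^esub> X = a \<odot>\<^bsub>?Q\<^esub> (b \<odot>\<^bsub>?Q\<^esub> X)"
      if "a \<in> carrier R" "b \<in> carrier R" "X \<in> carrier ?Q" for a b X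
      using that rep[of X] by (auto simp: sm smult_assoc1)
    show "\<one>\<^bsub>R\<^esub> \<odot>\<^bsub>?Q\<^esub> X = X" if "X \<in> carrier ?Q" for X
      using that rep[of X] by (auto simp: sm)
  qed
qed


section \<open>Torsion and rank\<close>

definition torsion_submodule :: "('a, 'r) ring_scheme \<Rightarrow> ('a, 'b, 'm) module_scheme \<Rightarrow> 'b set" where
  "torsion_submodule R M =
    {x \<in> carrier M. \<exists>a \<in> carrier R. a \<noteq> \<zero>\<^bsub>R\<^esub> \<and> a \<odot>\<^bsub>M\<^esub> x = \<zero>\<^bsub>M\<^esub>}"

lemma torsion_submodule_is_submodule:
  assumes "domain R" "Module.module R M"
  shows "submodule R (torsion_submodule R M) M"
proof -
  interpret R: domain R by fact
  interpret Module.module R M by fact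
  show ?thesis
  proof (rule submodule.intro)
    show "Module.module R M" by fact
    show "torsion_submodule R M \<subseteq> carrier M"
      by (auto simp: torsion_submodule_def)
    show "\<zero>\<^bsub>M\<^esub> \<in> torsion_submodule R M"
      unfolding torsion_submodule_def using R.one_not_zero smult_r_null[OF R.one_closed] by blast
  next
    fix x y assume "x \<in> torsion_submodule R M" "y \<in> torsion_submodule R M"
    then obtain a b where *: "x \<in> carrier M" "y \<in> carrier M" "a \<in> carrier R" "b \<in> carrier R"
      "a \<noteq> \<zero>\<^bsub>R\<^esub>" "b \<noteq> \<zero>\<^bsub>R\<^esub>" "a \<odot>\<^bsub>M\<^esub> x = \<zero>\<^bsub>M\<^esub>" "b \<odot>\<^bsub>M\<^esub> y = \<zero>\<^bsub>M\<^esub>"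
      by (auto simp: torsion_submodule_def)
    have "(b \<otimes>\<^bsub>R\<^esub> a) \<odot>\<^bsub>M\<^esub> x = \<zero>\<^bsub>M\<^esub>" "(a \<otimes>\<^bsub>R\<^esub> b) \<odot>\<^bsub>M\<^esub> y = \<zero>\<^bsub>M\<^esub>"
      using * by (simp_all only: smult_assoc1 smult_r_null)
    moreover have "b \<otimes>\<^bsub>R\<^esub> a = a \<otimes>\<^bsub>R\<^esub> b"
      using * by (simp add: R.m_comm)
    ultimately have "(a \<otimes>\<^bsub>R\<^esub> b) \<odot>\<^bsub>M\<^esub> (x \<oplus>\<^bsub>M\<^esub> y) = \<zero>\<^bsub>M\<^esub>"
      using * by (simp add: smult_r_distr)
    moreover have "a \<otimes>\<^bsub>R\<^esub> b \<noteq> \<zero>\<^bsub>R\<^esub>"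
      using * R.integral by blast
    ultimately show "x \<oplus>\<^bsub>M\<^esub> y \<in> torsion_submodule R M"
      using * unfolding torsion_submodule_def by blast
  next
    fix c x assume "c \<in> carrier R" "x \<in> torsion_submodule R M"
    then obtain a where *: "x \<in> carrier M" "a \<in> carrier R" "c \<in> carrier R"
      "a \<noteq> \<zero>\<^bsub>R\<^esub>" "a \<odot>\<^bsub>M\<^esub> x = \<zero>\<^bsub>M\<^esub>"
      by (auto simp: torsion_submodule_def)
    have "a \<odot>\<^bsub>M\<^esub> (c \<odot>\<^bsub>M\<^esub> x) = c \<odot>\<^bsub>M\<^esub> (a \<odot>\<^bsub>M\<^esub> x)"
      using * by (metis smult_assoc1 R.m_comm)
    then have "a \<odot>\<^bsub>M\<^esub> (c \<odot>\<^bsub>M\<^esub> x) = \<zero>\<^bsub>M\<^esub>"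
      using * by (simp add: smult_r_null)
    then show "c \<odot>\<^bsub>M\<^esub> x \<in> torsion_submodule R M"
      using * by (auto simp: torsion_submodule_def)
  qed
qed

definition module_basis :: "('a, 'r) ring_scheme \<Rightarrow> ('a, 'b, 'm) module_scheme \<Rightarrow> 'b set \<Rightarrow> bool" where
  "module_basis R M B \<longleftrightarrow> B \<subseteq> carrier M \<and> \<not> LinearCombinations.module.lin_dep R M B \<and>
     LinearCombinations.module.span R M B = carrier M"

text \<open>Meaningful only for a module with a finite basis over a nontrivial commutative ring, where
  all bases have the same cardinality; otherwise the value is unspecified.\<close>

definition free_rank :: "('a, 'r) ring_scheme \<Rightarrow> ('a, 'b, 'm) module_scheme \<Rightarrow> nat" where
  "free_rank R M = (THE n. \<exists>B. finite B \<and> module_basis R M B \<and> card B = n)"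

definition module_rank :: "('a, 'r) ring_scheme \<Rightarrow> ('a, 'b, 'm) module_scheme \<Rightarrow> nat" where
  "module_rank R M = free_rank R (quotient_module M (torsion_submodule R M))"


section \<open>Modules given by generators and relations\<close>

text \<open>The generators are the classes of the unit vectors of the free module of vectors of length
  \<open>\<mu>\<close>; the relations are the rows of \<open>P\<close>.\<close>

definition relation_submodule :: "nat \<Rightarrow> 'a::comm_ring_1 mat \<Rightarrow> 'a vec set" where
  "relation_submodule \<mu> P =
    LinearCombinations.module.span class_ring (module_vec TYPE('a) \<mu>) (set (rows P))"

definition presented_module :: "nat \<Rightarrow> 'a::comm_ring_1 mat \<Rightarrow> ('a, 'a vec set) module" where
  "presented_module \<mu> P = quotient_module (module_vec TYPE('a) \<mu>) (relation_submodule \<mu> P)"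

lemma presented_module_is_module:
  fixes P :: "'a::comm_ring_1 mat"
  assumes "P \<in> carrier_mat \<nu> \<mu>"
  shows "Module.module class_ring (presented_module \<mu> P)"
proof -
  interpret vec_module "TYPE('a)" \<mu> .
  have "set (rows P) \<subseteq> carrier_vec \<mu>"
    using assms rows_carrier[of P] by auto
  then have "submodule class_ring (relation_submodule \<mu> P) V"
    unfolding relation_submodule_def by (rule span_is_submodule)
  then show ?thesis
    unfolding presented_module_def by (rule quotient_module_is_module)
qed

end

theory Submission
  imports Defs
begin

text \<open>Let \<open>f\<close> be the projection of the free module \<open>R\<^sup>\<mu>\<close>, with \<open>R = k[s]\<close>, onto
  \<open>\<Lambda>\<close> modulo torsion. Its kernel is the saturation of the row module of \<open>P\<close>, that is, the set of vectors
  that lie in the row space of \<open>P\<close> over the fraction field. Hence, for every finite basis of the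
  quotient, lifts of its elements complement a basis of that row space to a basis of the
  \<open>\<mu>\<close>-dimensional vector space over the fraction field: the basis has \<open>\<mu> - rk(P)\<close> elements. A basis
  exists because a finitely generated torsion-free module over a Euclidean ring is free.\<close>

section \<open>Torsion-free modules over Euclidean rings\<close>

text \<open>Serves to check that a set still generates after a generator has been dropped or
  altered: only the old generators have to be recovered.\<close>

lemma gen_set_exchange:
  assumes "Module.module R M" "B \<subseteq> carrier M" "B' \<subseteq> carrier M"
    and "LinearCombinations.module.span R M B = carrier M"
    and "B \<subseteq> LinearCombinations.module.span R M B'"
  shows "LinearCombinations.module.span R M B' = carrier M"
proof -
  interpret Module.module R M by fact
  have "span B \<subseteq> span B'"
    using assms by (intro span_is_subset span_is_submodule)
  then show ?thesis
    using assms span_is_subset2 by blast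
qed

text \<open>The Euclidean algorithm, applied to the coefficients of a nontrivial relation between
  generators, ends with a relation in which a single generator survives; by torsion-freeness that
  generator is zero and can be dropped.\<close>

lemma smaller_gen_set:
  fixes M :: "('a::euclidean_ring, 'b, 'm) module_scheme"
  assumes M: "Module.module class_ring M"
    and tf: "\<And>a x. x \<in> carrier M \<Longrightarrow> a \<odot>\<^bsub>M\<^esub> x = \<zero>\<^bsub>M\<^esub> \<Longrightarrow> a = 0 \<or> x = \<zero>\<^bsub>M\<^esub>"
    and "finite B" "B \<subseteq> carrier M" "LinearCombinations.module.span class_ring M B = carrier M"
    and "LinearCombinations.module.lincomb M a B = \<zero>\<^bsub>M\<^esub>" "v \<in> B" "a v \<noteq> 0"
  shows "\<exists>B'. finite B' \<and> B' \<subseteq> carrier M \<and> card B' < card B \<and>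
    LinearCombinations.module.span class_ring M B' = carrier M"
  using assms(3-8)
\<comment> \<open>The measure is the total size of the coefficients. A division step changes a
  generator together with its coefficients, so \<open>B\<close>, \<open>a\<close> and
  \<open>v\<close> all vary.\<close>
proof (induction "\<Sum>x\<in>B. euclidean_size (a x)" arbitrary: B a v rule: less_induct)
  case less
  interpret Module.module class_ring M by (rule M)
  note fin = less.prems(1) and sub = less.prems(2) and gen = less.prems(3)
    and rel = less.prems(4) and v = less.prems(5,6)
  show ?case
  proof (cases "\<exists>w\<in>B. w \<noteq> v \<and> a w \<noteq> 0")
    case False
    \<comment> \<open>Only \<open>v\<close> survives, so the relation reads \<open>a v\<close> times
      \<open>v\<close> equals zero.\<close>
    have "a x \<odot>\<^bsub>M\<^esub> x = \<zero>\<^bsub>M\<^esub>" if "x \<in> B - {v}" for x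
    proof -
      have "x \<in> carrier M" "a x = 0"
        using False that sub by auto
      then show ?thesis
        using lmult_0[of x] by simp
    qed
    then have "lincomb a (B - {v}) = \<zero>\<^bsub>M\<^esub>"
      unfolding lincomb_def by (intro finsum_all0) auto
    moreover have "lincomb a B = a v \<odot>\<^bsub>M\<^esub> v \<oplus>\<^bsub>M\<^esub> lincomb a (B - {v})"
      using fin sub v by (intro lincomb_del2) auto
    ultimately have "a v \<odot>\<^bsub>M\<^esub> v = \<zero>\<^bsub>M\<^esub>"
      using rel v sub by auto
    then have "v = \<zero>\<^bsub>M\<^esub>"
      using tf v sub by blast
    have sm: "submodule class_ring (span (B - {v})) M"
      using sub by (intro span_is_submodule) auto
    have "B \<subseteq> span (B - {v})"
      using in_own_span[of "B - {v}"] sub submodule.zero_closed[OF sm] \<open>v = \<zero>\<^bsub>M\<^esub>\<close> by auto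
    then have "span (B - {v}) = carrier M"
      by (intro gen_set_exchange[OF M sub _ gen] Diff_subset[THEN subset_trans] sub)
    moreover have "finite (B - {v})" "B - {v} \<subseteq> carrier M"
      using fin sub by auto
    ultimately show ?thesis
      using card_Diff1_less[OF fin v(1)] by blast
  next
    case True
    \<comment> \<open>The pair is ordered so that the larger coefficient is divided by the smaller
      one: the remainder has size below that of \<open>a y\<close>, hence below that of
      \<open>a x\<close>.\<close>
    then obtain x y where xy: "x \<in> B" "y \<in> B" "x \<noteq> y" "a x \<noteq> 0" "a y \<noteq> 0"
      and le: "euclidean_size (a y) \<le> euclidean_size (a x)"
      using v by (metis linorder_le_cases)
    \<comment> \<open>Since \<open>a x = a x mod a y + a y * q\<close>, the terms of
      \<open>x\<close> and \<open>y\<close> regroup into \<open>a x mod a y\<close> times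
      \<open>x\<close> plus \<open>a y\<close> times \<open>z\<close>. Exchanging \<open>y\<close>
      for \<open>z\<close> thus preserves the relation and shrinks one coefficient.\<close>
    define q where "q = a x div a y"
    define z where "z = y \<oplus>\<^bsub>M\<^esub> q \<odot>\<^bsub>M\<^esub> x"
    define B' where "B' = insert z (B - {y})"
    have c: "x \<in> carrier M" "y \<in> carrier M"
      using xy sub by auto
    then have "z \<in> carrier M"
      by (simp add: z_def)
    note c = c this
    have B': "B' \<subseteq> carrier M" "finite B'"
      using sub fin c by (auto simp: B'_def)
    have sm: "submodule class_ring (span B') M"
      using B' by (intro span_is_submodule)
    have own: "B' \<subseteq> span B'"
      using B' by (intro in_own_span)
    have "y = z \<oplus>\<^bsub>M\<^esub> (- q) \<odot>\<^bsub>M\<^esub> x"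
    proof -
      have "z \<oplus>\<^bsub>M\<^esub> (- q) \<odot>\<^bsub>M\<^esub> x = y \<oplus>\<^bsub>M\<^esub> (q + (- q)) \<odot>\<^bsub>M\<^esub> x"
        using c smult_l_distr[of q "- q" x] by (simp add: z_def M.a_assoc)
      then show ?thesis
        using c lmult_0[of x] by simp
    qed
    moreover have "z \<in> span B'" "x \<in> span B'"
      using own xy by (auto simp: B'_def)
    ultimately have "y \<in> span B'"
      using sm by (metis submodule.m_closed submodule.smult_closed UNIV_I partial_object.select_convs(1))
    then have "B \<subseteq> span B'"
      using own by (auto simp: B'_def)
    then have gen': "span B' = carrier M"
      by (intro gen_set_exchange[OF M sub B'(1) gen])
    show ?thesis
    \<comment> \<open>If \<open>z\<close> is already another generator, the exchange itself lowers
      the cardinality; otherwise the cardinality is unchanged and the induction continues with the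
      new relation.\<close>
    proof (cases "z \<in> B - {y}")
      case True
      then have "B' = B - {y}"
        by (auto simp: B'_def)
      then have "card B' < card B"
        using card_Diff1_less[OF fin xy(2)] by simp
      then show ?thesis
        using B' gen' by blast
    next
      case zB: False
      \<comment> \<open>The nonzero coefficient \<open>a y\<close> passes to \<open>z\<close>, so
        \<open>z\<close> takes the role of \<open>v\<close> in the induction hypothesis, even if the
        remainder at \<open>x\<close> is zero.\<close>
      define a' where "a' = a(x := a x mod a y, z := a y)"
      define D where "D = B - {x, y}"
      have D: "finite D" "D \<subseteq> carrier M" "x \<notin> D" "y \<notin> D" "z \<notin> D"
        using fin sub zB xy by (auto simp: D_def)
      have BD: "B = insert x (insert y D)"
        using xy by (auto simp: D_def)
      have zx: "z \<noteq> x"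
        using zB xy by auto
      have B'D: "B' = insert x (insert z D)"
        using xy BD D by (auto simp: B'_def)
      have aD: "a' w = a w" if "w \<in> D" for w
        using that D by (auto simp: a'_def)
      have ins: "lincomb f (insert u E) = f u \<odot>\<^bsub>M\<^esub> u \<oplus>\<^bsub>M\<^esub> lincomb f E"
        if "finite E" "E \<subseteq> carrier M" "u \<notin> E" "u \<in> carrier M" for f :: "'b \<Rightarrow> 'a" and u E
        using lincomb_insert[of E f u] that by auto
      have qr: "a x mod a y + a y * q = a x"
        unfolding q_def by (rule mod_mult_div_eq)
      have distr: "(s + t) \<odot>\<^bsub>M\<^esub> w = s \<odot>\<^bsub>M\<^esub> w \<oplus>\<^bsub>M\<^esub> t \<odot>\<^bsub>M\<^esub> w" if "w \<in> carrier M" for s t w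
        using that smult_l_distr[of s t w]
        by (simp only: partial_object.select_convs ring.select_convs UNIV_I)
      have lD: "lincomb a' D = lincomb a D"
        using D aD by (intro lincomb_cong) auto
      have cD: "lincomb a D \<in> carrier M"
        using D by (intro lincomb_closed) auto
      have "lincomb a' B' = (a x mod a y) \<odot>\<^bsub>M\<^esub> x \<oplus>\<^bsub>M\<^esub> (a y \<odot>\<^bsub>M\<^esub> z \<oplus>\<^bsub>M\<^esub> lincomb a D)"
        unfolding B'D using D c zx xy lD by (simp add: ins a'_def)
      also have "a y \<odot>\<^bsub>M\<^esub> z = a y \<odot>\<^bsub>M\<^esub> y \<oplus>\<^bsub>M\<^esub> (a y * q) \<odot>\<^bsub>M\<^esub> x"
        using c smult_assoc1[of "a y" q x] by (simp add: z_def smult_r_distr)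
      also have "(a x mod a y) \<odot>\<^bsub>M\<^esub> x \<oplus>\<^bsub>M\<^esub> (a y \<odot>\<^bsub>M\<^esub> y \<oplus>\<^bsub>M\<^esub> (a y * q) \<odot>\<^bsub>M\<^esub> x \<oplus>\<^bsub>M\<^esub> lincomb a D) =
          ((a x mod a y) \<odot>\<^bsub>M\<^esub> x \<oplus>\<^bsub>M\<^esub> (a y * q) \<odot>\<^bsub>M\<^esub> x) \<oplus>\<^bsub>M\<^esub> (a y \<odot>\<^bsub>M\<^esub> y \<oplus>\<^bsub>M\<^esub> lincomb a D)"
        using c cD by (simp add: M.a_ac)
      also have "(a x mod a y) \<odot>\<^bsub>M\<^esub> x \<oplus>\<^bsub>M\<^esub> (a y * q) \<odot>\<^bsub>M\<^esub> x = a x \<odot>\<^bsub>M\<^esub> x"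
        using c distr[of x "a x mod a y" "a y * q"] qr by metis
      also have "a x \<odot>\<^bsub>M\<^esub> x \<oplus>\<^bsub>M\<^esub> (a y \<odot>\<^bsub>M\<^esub> y \<oplus>\<^bsub>M\<^esub> lincomb a D) = lincomb a B"
        unfolding BD using D c xy by (simp add: ins)
      finally have rel': "lincomb a' B' = \<zero>\<^bsub>M\<^esub>"
        using rel by simp
      have "(\<Sum>w\<in>D. euclidean_size (a' w)) = (\<Sum>w\<in>D. euclidean_size (a w))"
        using aD by (intro sum.cong) auto
      moreover have "euclidean_size (a x mod a y) < euclidean_size (a x)"
        using mod_size_less[of "a y" "a x"] xy le by simp
      ultimately have "(\<Sum>w\<in>B'. euclidean_size (a' w)) < (\<Sum>w\<in>B. euclidean_size (a w))"
        unfolding B'D BD using D zx xy by (simp add: a'_def)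
      moreover have "card B' = card B"
        unfolding B'D BD using D zx xy by simp
      moreover have "z \<in> B'" "a' z \<noteq> 0"
        using xy by (auto simp: B'_def a'_def)
      ultimately show ?thesis
        using less.hyps[OF _ B'(2,1) gen' rel', of z] by simp
    qed
  qed
qed

text \<open>A finite generating set of least cardinality is independent, because a nontrivial
  relation would produce a smaller one by \<open>smaller_gen_set\<close>.\<close>

lemma module_basis_exists:
  fixes M :: "('a::euclidean_ring, 'b, 'm) module_scheme"
  assumes M: "Module.module class_ring M"
    and tf: "\<And>a x. x \<in> carrier M \<Longrightarrow> a \<odot>\<^bsub>M\<^esub> x = \<zero>\<^bsub>M\<^esub> \<Longrightarrow> a = 0 \<or> x = \<zero>\<^bsub>M\<^esub>"
    and B: "finite B" "B \<subseteq> carrier M" "LinearCombinations.module.span class_ring M B = carrier M"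
  shows "\<exists>B'. finite B' \<and> module_basis class_ring M B'"
proof -
  interpret Module.module class_ring M by (rule M)
  let ?P = "\<lambda>B. finite B \<and> B \<subseteq> carrier M \<and> span B = carrier M"
  obtain C where C: "?P C" and min: "\<And>D. ?P D \<Longrightarrow> card C \<le> card D"
    using ex_has_least_nat[of ?P B card] B by auto
  have "lin_indpt C"
  proof
    assume "lin_dep C"
    then obtain a v where "lincomb a C = \<zero>\<^bsub>M\<^esub>" "v \<in> C" "a v \<noteq> 0"
      using finite_lin_dep[of C] C by auto
    then show False
      using smaller_gen_set[OF M tf, of C a v] C min by (meson not_le)
  qed
  then show ?thesis
    using C by (auto simp: module_basis_def)
qed

section \<open>Spans over the fraction field\<close>

abbreviation vec_span :: "nat \<Rightarrow> 'a::comm_ring_1 vec set \<Rightarrow> 'a vec set" where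
  "vec_span n A \<equiv> LinearCombinations.module.span class_ring (module_vec TYPE('a) n) A"

abbreviation fract_vec :: "'a::idom vec \<Rightarrow> 'a fract vec" where
  "fract_vec \<equiv> map_vec to_fract"

lemma fract_vec_add: "x \<in> carrier_vec n \<Longrightarrow> y \<in> carrier_vec n \<Longrightarrow>
    fract_vec (x + y) = fract_vec x + fract_vec y"
  by (intro eq_vecI) auto

lemma fract_vec_smult: "fract_vec (a \<cdot>\<^sub>v x) = to_fract a \<cdot>\<^sub>v fract_vec x"
  by (intro eq_vecI) auto

lemma fract_vec_zero: "fract_vec (0\<^sub>v n) = 0\<^sub>v n"
  by (intro eq_vecI) auto

lemma fract_vec_inj: "fract_vec x = fract_vec y \<Longrightarrow> x = y"
  by (metis eq_vecI index_map_vec to_fract_eq_iff)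

text \<open>The preimage of a subspace under \<open>fract_vec\<close> is a submodule; here it
  contains \<open>A\<close>.\<close>

lemma fract_vec_in_span:
  fixes A :: "'a::idom vec set"
  assumes A: "A \<subseteq> carrier_vec n" and x: "x \<in> vec_span n A"
  shows "fract_vec x \<in> vec_span n (fract_vec ` A)"
proof -
  interpret R: vec_module "TYPE('a)" n .
  interpret K: vec_space "TYPE('a fract)" n .
  have A': "fract_vec ` A \<subseteq> carrier_vec n"
    using A by auto
  have K: "submodule class_ring (K.span (fract_vec ` A)) K.V"
    using A' by (intro K.span_is_submodule)
  have "submodule class_ring {x \<in> carrier_vec n. fract_vec x \<in> K.span (fract_vec ` A)} R.V"
    using submodule.zero_closed[OF K] submodule.m_closed[OF K] submodule.smult_closed[OF K]
    by (intro submodule.intro R.module_axioms)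
      (auto simp: module_vec_simps fract_vec_zero fract_vec_add fract_vec_smult)
  moreover have "A \<subseteq> {x \<in> carrier_vec n. fract_vec x \<in> K.span (fract_vec ` A)}"
    using A K.in_own_span[of "fract_vec ` A"] A' by auto
  ultimately show ?thesis
    using x R.span_is_subset by blast
qed

text \<open>Clearing denominators: the vectors with a nonzero multiple coming from the span of
  \<open>A\<close> form a subspace over the fraction field, and it contains the images of
  \<open>A\<close>.\<close>

lemma span_fract_vec_denominator:
  fixes A :: "'a::idom vec set"
  assumes A: "A \<subseteq> carrier_vec n" and y: "y \<in> vec_span n (fract_vec ` A)"
  shows "\<exists>a x. a \<noteq> 0 \<and> x \<in> vec_span n A \<and> to_fract a \<cdot>\<^sub>v y = fract_vec x"
proof -
  interpret R: vec_module "TYPE('a)" n .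
  interpret K: vec_space "TYPE('a fract)" n .
  have R: "submodule class_ring (R.span A) R.V"
    using A by (intro R.span_is_submodule)
  note zeroR = submodule.zero_closed[OF R, unfolded module_vec_simps]
    and addR = submodule.m_closed[OF R, unfolded module_vec_simps]
    and smultR = submodule.smult_closed[OF R, unfolded module_vec_simps, simplified]
  have sub: "R.span A \<subseteq> carrier_vec n"
    using A by (rule R.span_is_subset2)
  let ?S = "{y \<in> carrier_vec n. \<exists>a x. a \<noteq> 0 \<and> x \<in> R.span A \<and> to_fract a \<cdot>\<^sub>v y = fract_vec x}"
  have "submodule class_ring ?S K.V"
  proof (rule submodule.intro)
    show "Module.module class_ring K.V"
      by (rule K.module_axioms)
    show "?S \<subseteq> carrier K.V"
      by auto
    show "\<zero>\<^bsub>K.V\<^esub> \<in> ?S"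
      using zeroR by (auto intro!: exI[of _ 1] exI[of _ "0\<^sub>v n"] simp: fract_vec_zero)
  next
    fix y z assume "y \<in> ?S" "z \<in> ?S"
    then obtain a b u v where *: "y \<in> carrier_vec n" "z \<in> carrier_vec n" "a \<noteq> 0" "b \<noteq> 0"
      "u \<in> R.span A" "v \<in> R.span A" "to_fract a \<cdot>\<^sub>v y = fract_vec u" "to_fract b \<cdot>\<^sub>v z = fract_vec v"
      by auto
    \<comment> \<open>The product of the two denominators serves as a common denominator of the
      sum.\<close>
    have "to_fract (a * b) \<cdot>\<^sub>v (y + z) = to_fract (b * a) \<cdot>\<^sub>v y + to_fract (a * b) \<cdot>\<^sub>v z"
      using * by (simp add: smult_add_distrib_vec mult.commute)
    also have "\<dots> = to_fract b \<cdot>\<^sub>v (to_fract a \<cdot>\<^sub>v y) + to_fract a \<cdot>\<^sub>v (to_fract b \<cdot>\<^sub>v z)"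
      by (simp only: smult_smult_assoc to_fract_mult)
    also have "\<dots> = fract_vec (b \<cdot>\<^sub>v u + a \<cdot>\<^sub>v v)"
      using * sub by (subst fract_vec_add[of _ n]) (auto simp: fract_vec_smult)
    finally show "y \<oplus>\<^bsub>K.V\<^esub> z \<in> ?S"
      using * addR smultR by (auto intro!: exI[of _ "a * b"] exI[of _ "b \<cdot>\<^sub>v u + a \<cdot>\<^sub>v v"])
  next
    fix c :: "'a fract" and y assume "y \<in> ?S"
    then obtain a u where *: "y \<in> carrier_vec n" "a \<noteq> 0" "u \<in> R.span A"
      "to_fract a \<cdot>\<^sub>v y = fract_vec u"
      by auto
    obtain p q where c: "c = Fract p q" "q \<noteq> 0"
      by (cases c)
    \<comment> \<open>The factor \<open>q\<close> clears the denominator of the scalar and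
      \<open>a\<close> that of the vector.\<close>
    have "to_fract (a * q) * c = to_fract p * to_fract a"
      using c by (simp add: Fract_conv_to_fract)
    then have "to_fract (a * q) \<cdot>\<^sub>v (c \<cdot>\<^sub>v y) = to_fract p \<cdot>\<^sub>v (to_fract a \<cdot>\<^sub>v y)"
      by (simp only: smult_smult_assoc)
    also have "\<dots> = fract_vec (p \<cdot>\<^sub>v u)"
      using * by (simp add: fract_vec_smult)
    finally show "c \<odot>\<^bsub>K.V\<^esub> y \<in> ?S"
      using * c smultR by (auto intro!: exI[of _ "a * q"] exI[of _ "p \<cdot>\<^sub>v u"])
  qed
  moreover have "fract_vec ` A \<subseteq> ?S"
    using A R.in_own_span[OF A] by (fastforce intro!: exI[of _ 1])
  ultimately show ?thesis
    using y K.span_is_subset by blast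
qed

text \<open>Translates torsion modulo the span of \<open>A\<close> into linear algebra over the
  fraction field: one direction divides by \<open>a\<close>, the other clears denominators and uses
  that \<open>fract_vec\<close> is injective.\<close>

lemma vec_span_saturation_iff:
  fixes A :: "'a::idom vec set"
  assumes A: "A \<subseteq> carrier_vec n" and x: "x \<in> carrier_vec n"
  shows "(\<exists>a. a \<noteq> 0 \<and> a \<cdot>\<^sub>v x \<in> vec_span n A) \<longleftrightarrow> fract_vec x \<in> vec_span n (fract_vec ` A)"
proof
  interpret K: vec_space "TYPE('a fract)" n .
  assume "\<exists>a. a \<noteq> 0 \<and> a \<cdot>\<^sub>v x \<in> vec_span n A"
  then obtain a where a: "a \<noteq> 0" "a \<cdot>\<^sub>v x \<in> vec_span n A"
    by blast
  have "fract_vec x = inverse (to_fract a) \<cdot>\<^sub>v fract_vec (a \<cdot>\<^sub>v x)"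
    using a(1) by (simp add: fract_vec_smult smult_smult_assoc)
  moreover have "fract_vec ` A \<subseteq> carrier_vec n"
    using A by auto
  ultimately show "fract_vec x \<in> vec_span n (fract_vec ` A)"
    using K.smult_in_span[OF _ fract_vec_in_span[OF A a(2)]] by metis
next
  assume "fract_vec x \<in> vec_span n (fract_vec ` A)"
  from span_fract_vec_denominator[OF A this]
  show "\<exists>a. a \<noteq> 0 \<and> a \<cdot>\<^sub>v x \<in> vec_span n A"
    by (metis fract_vec_smult fract_vec_inj)
qed

section \<open>Quotient modules and homomorphisms\<close>

text \<open>Homomorphism, image and kernel of the projection: with these the rank computation can
  avoid cosets.\<close>

lemma quotient_projection:
  assumes "submodule R N M"
  shows "mod_hom R M (quotient_module M N) (\<lambda>x. N +>\<^bsub>M\<^esub> x)"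
    and "(\<lambda>x. N +>\<^bsub>M\<^esub> x) ` carrier M = carrier (quotient_module M N)"
    and "x \<in> carrier M \<Longrightarrow> N +>\<^bsub>M\<^esub> x = \<zero>\<^bsub>quotient_module M N\<^esub> \<longleftrightarrow> x \<in> N"
proof -
  interpret submodule R N M by fact
  interpret Module.module R M by (rule module)
  interpret abelian_subgroup N M
    by (rule submodule_abelian_subgroup) fact
  show surj: "(\<lambda>x. N +>\<^bsub>M\<^esub> x) ` carrier M = carrier (quotient_module M N)"
    by (auto simp: quotient_module_def A_RCOSETS_def')
  show "mod_hom R M (quotient_module M N) (\<lambda>x. N +>\<^bsub>M\<^esub> x)"
  proof (intro mod_hom.intro mod_hom_axioms.intro)
    show "(+>\<^bsub>M\<^esub>) N \<in> LinearCombinations.module_hom R M (quotient_module M N)"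
      unfolding LinearCombinations.module_hom_def
      using surj quotient_module_smult[OF assms] a_rcos_sum
      by (auto simp: quotient_module_def)
  qed (auto simp: module_axioms quotient_module_is_module[OF assms])
  show "N +>\<^bsub>M\<^esub> x = \<zero>\<^bsub>quotient_module M N\<^esub> \<longleftrightarrow> x \<in> N" if "x \<in> carrier M"
    using that a_rcos_self[OF that] a_rcos_const
    by (auto simp: quotient_module_def)
qed

text \<open>If \<open>b\<close> annihilates a multiple \<open>a\<close> of a representative
  \<open>x\<close>, then \<open>b\<close> times \<open>a\<close> annihilates \<open>x\<close>. For
  \<open>x\<close> outside the torsion this product vanishes, and a domain forces \<open>a\<close>
  to be zero.\<close>

lemma quotient_torsion_free:
  assumes "domain R" "Module.module R M"
    and "X \<in> carrier (quotient_module M (torsion_submodule R M))" "a \<in> carrier R"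
    and "a \<odot>\<^bsub>quotient_module M (torsion_submodule R M)\<^esub> X = \<zero>\<^bsub>quotient_module M (torsion_submodule R M)\<^esub>"
  shows "a = \<zero>\<^bsub>R\<^esub> \<or> X = \<zero>\<^bsub>quotient_module M (torsion_submodule R M)\<^esub>"
proof (rule disjCI)
  interpret R: domain R by fact
  interpret Module.module R M by fact
  let ?T = "torsion_submodule R M"
  note T = torsion_submodule_is_submodule[OF assms(1,2)]
  assume "X \<noteq> \<zero>\<^bsub>quotient_module M ?T\<^esub>"
  obtain x where x: "x \<in> carrier M" "X = ?T +>\<^bsub>M\<^esub> x"
    using assms(3) quotient_projection(2)[OF T] by blast
  then have "x \<notin> ?T"
    using \<open>X \<noteq> _\<close> quotient_projection(3)[OF T] by blast
  have "?T +>\<^bsub>M\<^esub> (a \<odot>\<^bsub>M\<^esub> x) = \<zero>\<^bsub>quotient_module M ?T\<^esub>"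
    using assms(4,5) x quotient_module_smult[OF T] by simp
  then have "a \<odot>\<^bsub>M\<^esub> x \<in> ?T"
    using quotient_projection(3)[OF T, of "a \<odot>\<^bsub>M\<^esub> x"] assms(4) x by simp
  then obtain b where b: "b \<in> carrier R" "b \<noteq> \<zero>\<^bsub>R\<^esub>" "b \<odot>\<^bsub>M\<^esub> (a \<odot>\<^bsub>M\<^esub> x) = \<zero>\<^bsub>M\<^esub>"
    by (auto simp: torsion_submodule_def)
  then have "(b \<otimes>\<^bsub>R\<^esub> a) \<odot>\<^bsub>M\<^esub> x = \<zero>\<^bsub>M\<^esub>"
    using assms(4) x by (simp add: smult_assoc1)
  then have "b \<otimes>\<^bsub>R\<^esub> a = \<zero>\<^bsub>R\<^esub>"
    using \<open>x \<notin> ?T\<close> x b assms(4) unfolding torsion_submodule_def by blast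
  then show "a = \<zero>\<^bsub>R\<^esub>"
    using b assms(4) R.integral by blast
qed

lemma mod_hom_compose:
  assumes "mod_hom R L M f" "mod_hom R M N g"
  shows "mod_hom R L N (g \<circ> f)"
proof -
  interpret f: mod_hom R L M f by fact
  interpret g: mod_hom R M N g by fact
  show ?thesis
    by (intro mod_hom.intro mod_hom_axioms.intro f.M.module_axioms g.N.module_axioms)
      (auto simp: LinearCombinations.module_hom_def)
qed

lemma submodule_vimage:
  assumes "mod_hom R M N f" "submodule R S N"
  shows "submodule R {x \<in> carrier M. f x \<in> S} M"
proof -
  interpret f: mod_hom R M N f by fact
  interpret S: submodule R S N by fact
  show ?thesis
    by (intro submodule.intro f.M.module_axioms) auto
qed

lemma submodule_image:
  assumes "mod_hom R M N f" "submodule R S M"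
  shows "submodule R (f ` S) N"
proof -
  interpret f: mod_hom R M N f by fact
  interpret S: submodule R S M by fact
  show ?thesis
  proof (intro submodule.intro f.N.module_axioms)
    show "f ` S \<subseteq> carrier N"
      using S.subset by auto
    show "\<zero>\<^bsub>N\<^esub> \<in> f ` S"
      using S.zero_closed by (metis f.f0_is_0 imageI)
  next
    fix v w assume "v \<in> f ` S" "w \<in> f ` S"
    then obtain x y where "x \<in> S" "y \<in> S" "v = f x" "w = f y"
      by blast
    then show "v \<oplus>\<^bsub>N\<^esub> w \<in> f ` S"
      using S.subset S.m_closed[of x y] f.f_add[of x y] by (metis image_eqI subsetD)
  next
    fix c v assume "c \<in> carrier R" "v \<in> f ` S"
    then obtain x where "x \<in> S" "v = f x"
      by blast
    then show "c \<odot>\<^bsub>N\<^esub> v \<in> f ` S"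
      using S.subset S.smult_closed[of c x] f.f_smult[of c x] \<open>c \<in> carrier R\<close>
      by (metis image_eqI subsetD)
  qed
qed

section \<open>Row rank and column rank\<close>

text \<open>An element of \<open>S\<close> outside the span of \<open>U\<close> could be adjoined to
  \<open>U\<close>, against maximality.\<close>

lemma (in vec_space) span_maximal_indpt:
  assumes S: "S \<subseteq> carrier_vec n" and U: "maximal U (\<lambda>T. T \<subseteq> S \<and> lin_indpt T)"
  shows "span U = span S"
proof
  have U': "U \<subseteq> S" "lin_indpt U"
    using U by (auto simp: maximal_def)
  then show "span U \<subseteq> span S"
    by (simp add: span_is_monotone)
  have "s \<in> span U" if "s \<in> S" for s
  proof (rule ccontr)
    assume "s \<notin> span U"
    then have "s \<notin> U"
      using U' S in_own_span[of U] by auto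
    then have "lin_indpt (U \<union> {s})"
      using lin_dep_iff_in_span[of U s] \<open>s \<notin> span U\<close> U' S that by auto
    then show False
      using U \<open>s \<notin> U\<close> that U' unfolding maximal_def
      by (metis Un_insert_right insertCI insert_subset sup_bot.right_neutral subset_insertI)
  qed
  then show "span S \<subseteq> span U"
    using U' S by (intro span_subsetI) auto
qed

lemma (in vec_space) maximal_indpt_exists:
  assumes "finite S"
  obtains U where "maximal U (\<lambda>T. T \<subseteq> S \<and> lin_indpt T)" "finite U"
proof -
  have "lin_indpt {}"
    unfolding lin_dep_def by auto
  then show ?thesis
    using maximal_exists_superset[of S "\<lambda>T. T \<subseteq> S \<and> lin_indpt T" "{}"] assms that by auto
qed

text \<open>A rank factorization \<open>A = C U\<close> bounds the rank of \<open>A\<^sup>T = U\<^sup>T C\<^sup>T\<close> by the number of columns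
  of \<open>C\<close>.\<close>

lemma rank_transpose_le:
  fixes A :: "'a::field mat"
  assumes A: "A \<in> carrier_mat n m"
  shows "vec_space.rank m A\<^sup>T \<le> vec_space.rank n A"
proof -
  interpret N: vec_space "TYPE('a)" n .
  interpret M: vec_space "TYPE('a)" m .
  have cA: "set (cols A) \<subseteq> carrier_vec n"
    using A cols_dim by blast
  obtain S where S: "maximal S (\<lambda>T. T \<subseteq> set (cols A) \<and> N.lin_indpt T)" "finite S"
    using N.maximal_indpt_exists[of "set (cols A)"] by auto
  then obtain xs where xs: "set xs = S" "distinct xs"
    using finite_distinct_list by blast
  have Ssub: "S \<subseteq> carrier_vec n"
    using S(1) cA by (auto simp: maximal_def)
  define r where "r = length xs"
  have r: "N.rank A = r"
    using N.rank_card_indpt[OF A S(1)] xs distinct_card[of xs] by (simp add: r_def)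
  \<comment> \<open>The columns of \<open>C\<close> form a basis of the column space of
    \<open>A\<close>.\<close>
  define C where "C = mat_of_cols n xs"
  have C: "C \<in> carrier_mat n r"
    by (simp add: C_def r_def)
  have colsC: "set (cols C) = S"
    using xs Ssub by (simp add: C_def cols_mat_of_cols)
  have "\<exists>u\<in>carrier_vec r. C *\<^sub>v u = col A j" if "j < m" for j
  proof -
    have "col A j \<in> set (cols A)"
      using A that by (metis carrier_matD(2) cols_length cols_nth nth_mem)
    then have "col A j \<in> N.span (set (cols A))"
      using N.in_own_span[of "set (cols A)"] cA by auto
    also have "N.span (set (cols A)) = N.col_space C"
      using N.span_maximal_indpt[OF cA S(1)] colsC by (simp add: N.col_space_def)
    finally show ?thesis
      using N.col_space_eq[OF C] C by auto
  qed
  then obtain u where u: "\<And>j. j < m \<Longrightarrow> u j \<in> carrier_vec r" "\<And>j. j < m \<Longrightarrow> C *\<^sub>v u j = col A j"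
    by metis
  \<comment> \<open>Column \<open>j\<close> of \<open>U\<close> holds coordinates of column
    \<open>j\<close> of \<open>A\<close> with respect to the columns of \<open>C\<close>.\<close>
  define U where "U = mat_of_cols r (map u [0..<m])"
  have U: "U \<in> carrier_mat r m"
    unfolding U_def by (rule carrier_matI) auto
  have "A = C * U"
  proof (rule mat_col_eqI)
    show "col A j = col (C * U) j" if "j < dim_col (C * U)" for j
    proof -
      have j: "j < m"
        using that U by auto
      then have "col (C * U) j = C *\<^sub>v col U j"
        using C U by (intro col_mult2) auto
      also have "col U j = u j"
        using j u by (simp add: U_def)
      finally show ?thesis
        using u j by simp
    qed
  qed (use A C U in auto)
  then have AT: "A\<^sup>T = U\<^sup>T * C\<^sup>T"
    using C U transpose_mult by blast
  have UT: "U\<^sup>T \<in> carrier_mat m r" and CT: "C\<^sup>T \<in> carrier_mat r n"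
    using C U by auto
  have cUT: "set (cols U\<^sup>T) \<subseteq> carrier_vec m"
    using UT cols_dim by blast
  \<comment> \<open>By the factorization, each column of the transpose of \<open>A\<close> is a
    combination of the \<open>r\<close> columns of the transpose of \<open>U\<close>.\<close>
  have "set (cols A\<^sup>T) \<subseteq> M.span (set (cols U\<^sup>T))"
  proof
    fix x assume "x \<in> set (cols A\<^sup>T)"
    then obtain i where i: "i < n" "x = col A\<^sup>T i"
      using A by (metis carrier_matD(1) cols_length cols_nth in_set_conv_nth index_transpose_mat(3))
    then have "x = U\<^sup>T *\<^sub>v col C\<^sup>T i"
      unfolding AT using UT CT by (metis col_mult2)
    moreover have "col C\<^sup>T i \<in> carrier_vec r"
      using CT i by auto
    ultimately show "x \<in> M.span (set (cols U\<^sup>T))"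
      using M.col_space_eq[OF UT] UT unfolding M.col_space_def by auto
  qed
  then have sub: "M.span (set (cols A\<^sup>T)) \<subseteq> M.span (set (cols U\<^sup>T))"
    using cUT by (intro M.span_subsetI)
  have "set (cols A\<^sup>T) \<subseteq> carrier_vec m"
    using A cols_dim[of "A\<^sup>T"] by auto
  have sb: "subspace class_ring (M.span (set (cols U\<^sup>T))) M.V" 
    using cUT by (intro M.span_is_subspace) simp
  have "subspace class_ring (M.span (set (cols A\<^sup>T))) (M.vs (M.span (set (cols U\<^sup>T))))"
    using sub sb cUT \<open>set (cols A\<^sup>T) \<subseteq> carrier_vec m\<close>
    by (intro M.nested_subspaces M.span_is_subspace) auto
  then have "vec_space.rank m A\<^sup>T \<le> vec_space.rank m U\<^sup>T"
    unfolding M.rank_def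
    using vectorspace.subspace_dim[OF M.subspace_is_vs[OF sb]] M.fin_dim_span_cols[OF UT]
      M.fin_dim_span_cols[of "A\<^sup>T" n] A by auto
  also have "\<dots> \<le> r"
    using M.rank_le_nc[OF UT] .
  finally show ?thesis
    using r by simp
qed

text \<open>\<open>vec_space.rank\<close> is the dimension of the column space, whereas the
  relations are the rows of \<open>P\<close>; this lemma connects the two.\<close>

lemma rank_transpose:
  fixes A :: "'a::field mat"
  assumes "A \<in> carrier_mat n m"
  shows "vec_space.rank m A\<^sup>T = vec_space.rank n A"
  using rank_transpose_le[OF assms] rank_transpose_le[of "A\<^sup>T" m n] assms by simp

section \<open>The rank of a presented module\<close>

text \<open>Only a surjection with the right kernel is required of \<open>Q\<close>, so the iterated
  quotient stays out of the argument. As \<open>B\<close> is an arbitrary finite basis, the formula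
  also shows that all finite bases have equally many elements.\<close>

lemma card_basis_modulo_saturation:
  fixes A :: "'a::idom vec set" and Q :: "('a, 'b, 'm) module_scheme"
  assumes A: "A \<subseteq> carrier_vec n" "finite A"
    and hom: "mod_hom class_ring (module_vec TYPE('a) n) Q f"
    and surj: "f ` carrier_vec n = carrier Q"
    and ker: "\<And>x. x \<in> carrier_vec n \<Longrightarrow>
      f x = \<zero>\<^bsub>Q\<^esub> \<longleftrightarrow> (\<exists>a. a \<noteq> 0 \<and> a \<cdot>\<^sub>v x \<in> vec_span n A)"
    and B: "finite B" "module_basis class_ring Q B"
  shows "card B + vectorspace.dim class_ring
    (module_vec TYPE('a fract) n\<lparr>carrier := vec_span n (fract_vec ` A)\<rparr>) = n"
proof -
  interpret R: vec_module "TYPE('a)" n .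
  interpret K: vec_space "TYPE('a fract)" n .
  interpret Q: Module.module class_ring Q
    using hom by (simp add: mod_hom_def)
  interpret f: mod_hom class_ring R.V Q f by (rule hom)
  have f_add: "f (x + y) = f x \<oplus>\<^bsub>Q\<^esub> f y" if "x \<in> carrier_vec n" "y \<in> carrier_vec n" for x y
    using f.f_add[of x y] that by (simp add: module_vec_simps)
  have f_smult: "f (a \<cdot>\<^sub>v x) = a \<odot>\<^bsub>Q\<^esub> f x" if "x \<in> carrier_vec n" for a x
    using f.f_smult[of a x] that by (simp add: module_vec_simps)
  have BQ: "B \<subseteq> carrier Q" "Q.lin_indpt B" "Q.span B = carrier Q"
    using B(2) by (auto simp: module_basis_def)
  have "\<forall>b\<in>B. \<exists>x\<in>carrier_vec n. f x = b"
    using BQ(1) unfolding surj[symmetric] by blast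
  then obtain s where s: "\<And>b. b \<in> B \<Longrightarrow> s b \<in> carrier_vec n" "\<And>b. b \<in> B \<Longrightarrow> f (s b) = b"
    by metis
  let ?A = "fract_vec ` A"
  let ?s = "\<lambda>b. fract_vec (s b)"
  have A': "?A \<subseteq> carrier_vec n" "finite ?A"
    using A by auto
  obtain S where S: "maximal S (\<lambda>T. T \<subseteq> ?A \<and> K.lin_indpt T)" "finite S"
    using K.maximal_indpt_exists[OF A'(2)] by blast
  have S': "S \<subseteq> ?A" "S \<subseteq> carrier_vec n" "K.lin_indpt S"
    using S(1) A' by (auto simp: maximal_def)
  have dimS: "vectorspace.dim class_ring (K.vs (K.span ?A)) = card S"
    using K.dim_span[OF _ A'(2) S(1)] A' by simp
  have spanS: "K.span S = K.span ?A"
    using K.span_maximal_indpt[OF A'(1) S(1)] .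

  \<comment> \<open>Otherwise, after clearing denominators, a nonzero multiple \<open>a\<close> of
    \<open>s b\<close> lies in the span of \<open>A\<close> and the lifts of \<open>T\<close>. Since
    \<open>f\<close> kills \<open>A\<close>, the multiple \<open>a\<close> of \<open>b\<close> lies
    in the span of \<open>T\<close>, against the independence of \<open>B\<close>.\<close>
  have notin: "?s b \<notin> K.span (S \<union> ?s ` T)" if b: "b \<in> B" "b \<notin> T" and T: "T \<subseteq> B" for b T
  proof
    assume "?s b \<in> K.span (S \<union> ?s ` T)"
    also have "K.span (S \<union> ?s ` T) \<subseteq> K.span (fract_vec ` (A \<union> s ` T))"
      using S' by (intro K.span_is_monotone) auto
    finally have mem: "?s b \<in> K.span (fract_vec ` (A \<union> s ` T))" .
    have AT: "A \<union> s ` T \<subseteq> carrier_vec n"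
      using A s T by auto
    obtain a where a: "a \<noteq> 0" "a \<cdot>\<^sub>v s b \<in> R.span (A \<union> s ` T)"
      using vec_span_saturation_iff[OF AT s(1)[OF b(1)]] mem by blast
    have TQ: "T \<subseteq> carrier Q"
      using T BQ by blast
    have smT: "submodule class_ring (Q.span T) Q"
      by (rule Q.span_is_submodule[OF TQ])
    have fA: "f x \<in> Q.span T" if "x \<in> A" for x
    proof -
      have "1 \<cdot>\<^sub>v x \<in> vec_span n A"
        using that A R.in_own_span[OF A(1)] by auto
      then have "f x = \<zero>\<^bsub>Q\<^esub>"
        using ker[of x] that A by (metis subsetD zero_neq_one)
      then show ?thesis
        using submodule.zero_closed[OF smT] by simp
    qed
    have "f (s t) \<in> Q.span T" if "t \<in> T" for t
      using that s(2)[of t] T Q.in_own_span[OF TQ] by (metis subsetD)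
    then have "A \<union> s ` T \<subseteq> {x \<in> carrier R.V. f x \<in> Q.span T}"
      using AT fA by (auto simp: module_vec_simps)
    then have "R.span (A \<union> s ` T) \<subseteq> {x \<in> carrier R.V. f x \<in> Q.span T}"
      by (intro R.span_is_subset submodule_vimage[OF hom smT])
    then have "f (a \<cdot>\<^sub>v s b) \<in> Q.span T"
      using a by auto
    then have ab: "a \<odot>\<^bsub>Q\<^esub> b \<in> Q.span T"
      using f_smult s b by simp
    have finT: "finite T"
      using T B finite_subset by blast
    then obtain c where c: "Q.lincomb c T = a \<odot>\<^bsub>Q\<^esub> b"
      using Q.finite_in_span[OF _ TQ ab] by auto
    \<comment> \<open>The coefficient \<open>- a\<close> at \<open>b\<close> turns the membership
      into a relation, nontrivial because \<open>a\<close> is nonzero.\<close>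
    define c' where "c' = c(b := - a)"
    have bQ: "b \<in> carrier Q"
      using b BQ by blast
    have "Q.lincomb c' (T \<union> {b}) = c' b \<odot>\<^bsub>Q\<^esub> b \<oplus>\<^bsub>Q\<^esub> Q.lincomb c' T"
      using finT TQ bQ b by (intro Q.lincomb_insert) auto
    also have "Q.lincomb c' T = a \<odot>\<^bsub>Q\<^esub> b"
      unfolding c[symmetric] using TQ b by (intro Q.lincomb_cong) (auto simp: c'_def)
    also have "c' b \<odot>\<^bsub>Q\<^esub> b \<oplus>\<^bsub>Q\<^esub> a \<odot>\<^bsub>Q\<^esub> b = (- a + a) \<odot>\<^bsub>Q\<^esub> b"
      using Q.smult_l_distr[of "- a" a b] bQ by (simp add: c'_def)
    also have "\<dots> = \<zero>\<^bsub>Q\<^esub>"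
      using Q.lmult_0[of b] bQ by simp
    finally have rel: "Q.lincomb c' (T \<union> {b}) = \<zero>\<^bsub>Q\<^esub>" .
    have "Q.lin_dep B"
      using finT T b a by (intro Q.lin_dep_crit[OF _ _ _ _ _ rel, where v = b]) (auto simp: c'_def)
    then show False
      using BQ by simp
  qed

  \<comment> \<open>The lifts are adjoined to \<open>S\<close> one at a time. By
    \<open>notin\<close> each one is outside the previous span, which gives independence and also
    excludes coincidences that would lower the cardinality.\<close>
  have indpt: "K.lin_indpt (S \<union> ?s ` T) \<and> card (S \<union> ?s ` T) = card S + card T" if "T \<subseteq> B" for T
    using finite_subset[OF that B(1)] that
  proof (induction T)
    case empty
    then show ?case
      using S' by simp
  next
    case (insert b T)
    have sub: "S \<union> ?s ` T \<subseteq> carrier_vec n"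
      using S' s insert by auto
    have b: "?s b \<notin> K.span (S \<union> ?s ` T)"
      using insert by (intro notin) auto
    then have new: "?s b \<notin> S \<union> ?s ` T"
      using K.in_own_span[of "S \<union> ?s ` T"] sub by auto
    have "?s b \<in> carrier_vec n"
      using s insert by simp
    then have "K.lin_indpt (S \<union> ?s ` T \<union> {?s b})"
      using K.lin_dep_iff_in_span[of "S \<union> ?s ` T" "?s b"] b new sub insert by auto
    then show ?case
      using new insert S(2) by simp
  qed

  define W where "W = S \<union> ?s ` B"
  have W: "W \<subseteq> carrier_vec n" "finite W"
    using S' S(2) s B by (auto simp: W_def)
  have smW: "submodule class_ring (K.span W) K.V"
    using W by (intro K.span_is_submodule)
  note mW = submodule.m_closed[OF smW, unfolded module_vec_simps]
  \<comment> \<open>\<open>W\<close> is to be shown to span the whole space. The submodule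
    \<open>Y\<close> collects the integral vectors already reached; its image under \<open>f\<close>
    contains the basis \<open>B\<close>, hence is all of \<open>Q\<close>.\<close>
  define Y where "Y = {x \<in> carrier_vec n. fract_vec x \<in> K.span W}"
  have smY: "submodule class_ring Y R.V"
    using submodule.zero_closed[OF smW] submodule.m_closed[OF smW] submodule.smult_closed[OF smW]
    unfolding Y_def by (intro submodule.intro R.module_axioms)
      (auto simp: module_vec_simps fract_vec_zero fract_vec_add fract_vec_smult)
  have "B \<subseteq> f ` Y"
  proof
    fix b assume "b \<in> B"
    then have "?s b \<in> K.span W"
      using K.in_own_span[of W] W by (auto simp: W_def)
    then show "b \<in> f ` Y"
      using s \<open>b \<in> B\<close> by (intro image_eqI[of _ _ "s b"]) (auto simp: Y_def)
  qed
  then have YQ: "carrier Q \<subseteq> f ` Y"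
    using Q.span_is_subset[OF _ submodule_image[OF hom smY]] BQ by blast
  have all: "fract_vec x \<in> K.span W" if x: "x \<in> carrier_vec n" for x
  proof -
    have "f x \<in> f ` Y"
      using YQ surj x by blast
    then obtain y where y: "y \<in> carrier_vec n" "fract_vec y \<in> K.span W" "f x = f y"
      by (auto simp: Y_def)
    \<comment> \<open>The difference of two vectors with the same image lies in the kernel, hence
      over the fraction field in the span of \<open>?A\<close>, which is part of the span of
      \<open>W\<close>; then \<open>x\<close> is recovered as \<open>z + y\<close>.\<close>
    define z where "z = x + (- 1) \<cdot>\<^sub>v y"
    have z: "z \<in> carrier_vec n"
      using x y by (simp add: z_def)
    have "f z = f y \<oplus>\<^bsub>Q\<^esub> (- 1) \<odot>\<^bsub>Q\<^esub> f y"
      using x y by (simp add: z_def f_add f_smult)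
    also have "\<dots> = f (y + (- 1) \<cdot>\<^sub>v y)"
      using y by (simp add: f_add f_smult)
    also have "y + (- 1) \<cdot>\<^sub>v y = 0\<^sub>v n"
      using y by auto
    also have "f (0\<^sub>v n) = \<zero>\<^bsub>Q\<^esub>"
      using f.f0_is_0 by (simp add: module_vec_simps)
    finally have "fract_vec z \<in> K.span ?A"
      using ker[OF z] vec_span_saturation_iff[OF A(1) z] by blast
    also have "K.span ?A \<subseteq> K.span W"
      unfolding spanS[symmetric] W_def by (intro K.span_is_monotone) auto
    finally have "fract_vec z + fract_vec y \<in> K.span W"
      using mW y by blast
    also have "fract_vec z + fract_vec y = fract_vec (z + y)"
      using z y by (simp add: fract_vec_add)
    also have "z + y = x"
      using x y by (auto simp: z_def)
    finally show ?thesis .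
  qed
  \<comment> \<open>The unit vectors over the fraction field have integral entries, so
    \<open>all\<close> applies to them.\<close>
  have "set (unit_vecs n) \<subseteq> K.span W"
  proof
    fix u :: "'a fract vec" assume "u \<in> set (unit_vecs n)"
    then obtain i where "i < n" "u = unit_vec n i"
      by (auto simp: unit_vecs_def)
    then have "u = fract_vec (unit_vec n i)"
      by (intro eq_vecI) auto
    then show "u \<in> K.span W"
      using all[of "unit_vec n i"] by simp
  qed
  then have "K.span W = carrier_vec n"
    using K.span_unit_vecs_is_carrier K.span_subsetI[OF W(1)] K.span_is_subset2[of W] W by blast
  then have "K.basis W"
    using indpt[of B] W by (simp add: K.basis_def W_def)
  then have "n = card W"
    using K.dim_basis[OF W(2)] K.dim_is_n by simp
  then show ?thesis
    using indpt[of B] dimS by (simp add: W_def)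
qed

lemma set_unit_vecs_carrier: "set (unit_vecs n) \<subseteq> carrier_vec n"
  by (auto simp: unit_vecs_def)

text \<open>The matrix with the unit vectors as columns is the identity, so the entries of
  \<open>x\<close> are its coefficients.\<close>

lemma (in vec_module) span_unit_vecs: "span (set (unit_vecs n)) = carrier_vec n"
proof
  show "span (set (unit_vecs n)) \<subseteq> carrier_vec n"
    by (intro span_is_subset2 set_unit_vecs_carrier)
  show "carrier_vec n \<subseteq> span (set (unit_vecs n))"
  proof
    fix x :: "'a vec" assume x: "x \<in> carrier_vec n"
    have len: "length (unit_vecs n :: 'a vec list) = n"
      by (simp add: unit_vecs_def)
    have "mat_of_cols n (unit_vecs n) = (1\<^sub>m n :: 'a mat)"
      by (intro eq_matI) (auto simp: mat_of_cols_def unit_vecs_def)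
    moreover have "\<forall>w\<in>set (unit_vecs n :: 'a vec list). dim_vec w = n"
      by (simp add: unit_vecs_def)
    moreover have "vec n (($) x) = x"
      using x by auto
    ultimately have "lincomb_list (($) x) (unit_vecs n) = x"
      using x len by (simp only: lincomb_list_as_mat_mult one_mult_mat_vec)
    then have "x = lincomb (mk_coeff (unit_vecs n) (($) x)) (set (unit_vecs n))"
      using lincomb_list_as_lincomb[OF set_unit_vecs_carrier, of "($) x"] by simp
    then show "x \<in> span (set (unit_vecs n))"
      unfolding span_def by blast
  qed
qed

theorem proposition10:
  fixes P :: "'k::field poly mat" and \<mu> \<nu> :: nat
  assumes "P \<in> carrier_mat \<nu> \<mu>"
  shows "int (module_rank class_ring (presented_module \<mu> P)) =
    int \<mu> - int (vec_space.rank \<nu> (map_mat to_fract P))"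
proof -
  let ?F = "module_vec TYPE('k poly) \<mu>"
  let ?E = "relation_submodule \<mu> P"
  let ?L = "presented_module \<mu> P"
  let ?T = "torsion_submodule class_ring ?L"
  let ?Q = "quotient_module ?L ?T"
  let ?P = "map_mat to_fract P"
  interpret R: vec_module "TYPE('k poly)" \<mu> .
  interpret K: vec_space "TYPE('k poly fract)" \<mu> .
  have dom: "domain (class_ring :: 'k poly ring)"
    by unfold_locales auto
  have rowsP: "set (rows P) \<subseteq> carrier_vec \<mu>"
    using assms rows_carrier[of P] by auto
  have E: "submodule class_ring ?E ?F"
    unfolding relation_submodule_def using rowsP by (rule R.span_is_submodule)
  have L: "Module.module class_ring ?L"
    by (rule presented_module_is_module) fact
  have T: "submodule class_ring ?T ?L"
    by (rule torsion_submodule_is_submodule[OF dom L])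
  define p where "p = (\<lambda>x. ?E +>\<^bsub>?F\<^esub> x)"
  \<comment> \<open>Two projections in succession: first modulo the relations, then modulo
    torsion.\<close>
  define f where "f = (\<lambda>X. ?T +>\<^bsub>?L\<^esub> X) \<circ> p"
  have p: "mod_hom class_ring ?F ?L p" "p ` carrier_vec \<mu> = carrier ?L"
    "\<And>x. x \<in> carrier_vec \<mu> \<Longrightarrow> p x = \<zero>\<^bsub>?L\<^esub> \<longleftrightarrow> x \<in> ?E"
    using quotient_projection[OF E] unfolding p_def presented_module_def
    by (simp_all add: module_vec_simps)
  have hom: "mod_hom class_ring ?F ?Q f"
    unfolding f_def by (rule mod_hom_compose[OF p(1) quotient_projection(1)[OF T]])
  have surj: "f ` carrier_vec \<mu> = carrier ?Q"
    unfolding f_def using quotient_projection(2)[OF T] p(2) by (simp only: image_comp[symmetric])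
  have ker: "f x = \<zero>\<^bsub>?Q\<^esub> \<longleftrightarrow> (\<exists>a. a \<noteq> 0 \<and> a \<cdot>\<^sub>v x \<in> vec_span \<mu> (set (rows P)))"
    if x: "x \<in> carrier_vec \<mu>" for x
  proof -
    have px: "p x \<in> carrier ?L"
      using p(2) x by blast
    \<comment> \<open>An element \<open>p x\<close> is torsion exactly when some nonzero multiple of
      \<open>x\<close> lies in the relation module, which is the saturation condition.\<close>
    have "a \<odot>\<^bsub>?L\<^esub> p x = \<zero>\<^bsub>?L\<^esub> \<longleftrightarrow> a \<cdot>\<^sub>v x \<in> ?E" for a
      using module_hom_smult[OF mod_hom.f_hom[OF p(1)], of a x] p(3)[of "a \<cdot>\<^sub>v x"] x
      by (simp add: module_vec_simps)
    then show ?thesis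
      using quotient_projection(3)[OF T px] px
      by (auto simp: f_def torsion_submodule_def relation_submodule_def)
  qed
  have cP: "?P\<^sup>T \<in> carrier_mat \<mu> \<nu>" "?P \<in> carrier_mat \<nu> \<mu>"
    using assms by auto
  have "rows ?P = map fract_vec (rows P)"
    by (intro nth_equalityI) (auto intro!: eq_vecI)
  then have "set (cols ?P\<^sup>T) = fract_vec ` set (rows P)"
    by simp
  then have rank: "vec_space.rank \<nu> ?P = vectorspace.dim class_ring
      (module_vec TYPE('k poly fract) \<mu>\<lparr>carrier := vec_span \<mu> (fract_vec ` set (rows P))\<rparr>)"
    using rank_transpose[OF cP(2)] by (simp add: K.rank_def)
  have card: "card B + vec_space.rank \<nu> ?P = \<mu>"
    if "finite B" "module_basis class_ring ?Q B" for B
    unfolding rank using that by (intro card_basis_modulo_saturation[OF rowsP _ hom surj ker]) auto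
  have Q: "Module.module class_ring ?Q"
    by (rule quotient_module_is_module[OF T])
  interpret Q: Module.module class_ring ?Q by (rule Q)
  \<comment> \<open>The images of the unit vectors are a finite generating set of the torsion-free
    quotient, as \<open>module_basis_exists\<close> demands.\<close>
  let ?G = "f ` set (unit_vecs \<mu>)"
  have GQ: "?G \<subseteq> carrier ?Q"
    using surj set_unit_vecs_carrier by blast
  have "Q.span ?G = carrier ?Q"
  proof
    have sm: "submodule class_ring {x \<in> carrier ?F. f x \<in> Q.span ?G} ?F"
      by (intro submodule_vimage[OF hom] Q.span_is_submodule GQ)
    have "set (unit_vecs \<mu>) \<subseteq> {x \<in> carrier ?F. f x \<in> Q.span ?G}"
      using Q.in_own_span[OF GQ] set_unit_vecs_carrier by (auto simp: module_vec_simps)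
    then have "carrier_vec \<mu> \<subseteq> {x \<in> carrier ?F. f x \<in> Q.span ?G}"
      using R.span_is_subset[OF _ sm] R.span_unit_vecs by blast
    then show "carrier ?Q \<subseteq> Q.span ?G"
      unfolding surj[symmetric] by blast
  qed (rule Q.span_is_subset2[OF GQ])
  then obtain B where B: "finite B" "module_basis class_ring ?Q B"
    using module_basis_exists[OF Q _ _ GQ] quotient_torsion_free[OF dom L] by auto
  have "module_rank class_ring ?L = card B"
    unfolding module_rank_def free_rank_def
  proof (rule the_equality)
    \<comment> \<open>The description in \<open>free_rank\<close> is unique: \<open>card\<close>
      determines the size of every finite basis.\<close>
    show "n = card B" if "\<exists>B. finite B \<and> module_basis class_ring ?Q B \<and> card B = n" for n
      using that card[OF B] card by fastforce
  qed (use B in blast)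
  then show ?thesis
    using card[OF B] by simp
qed

end
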